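(* Let $[\alpha,\beta]\subset[0,1]$, $\epsilon>0$ and let $n\ge 1$ be an integer. Let $U(u)=u$ for $u\in[0,1]$ and let $U_n$ be the empirical CDF built from $n$ i.i.d. samples from the uniform distribution on $[0,1]$. Let $\overline{n}_{\beta,\epsilon}=\lceil n(\beta-\epsilon)\rceil$, $n_\alpha=n(\alpha-\epsilon)$ and $\tilde m=\min\{\lfloor n_\alpha\rfloor+1,\ \overline{n}_{\beta,\epsilon}-1\}$. If $n_\alpha>0$, then $$\Pr\Big(\sup_{u\in[\alpha,\beta]}U(u)-U_n(u)>\epsilon\Big)=\sum_{\ell=0}^{\tilde m}\binom{n}{\ell}\Big(\min\Big\{1-\frac{\ell}{n}-\epsilon,\ 1-\alpha\Big\}\Big)^{n-\ell}\alpha^\ell$$ $$\qquad+\sum_{\ell=\tilde m+1}^{\overline{n}_{\beta,\epsilon}-1}\binom{n}{\ell}\Big(1-\frac{\ell}{n}-\epsilon\Big)^{n-\ell}\Big[\epsilon\Big(\frac{\ell}{n}+\epsilon\Big)^{\ell-1}+\sum_{j=0}^{\tilde m-1}\frac{n_\alpha-j}{n}\binom{\ell}{j}\Big(\frac{\ell-n_\alpha}{n}\Big)^{\ell-j-1}\alpha^j\Big].$$ If $n_\alpha<0$, then $$\Pr\Big(\sup_{u\in[\alpha,\beta]}U(u)-U_n(u)>\epsilon\Big)=\sum_{\ell=0}^{\overline{n}_{\beta,\epsilon}-1}\binom{n}{\ell}\Big(1-\frac{\ell}{n}-\epsilon\Big)^{n-\ell}\epsilon\Big(\frac{\ell}{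n}+\epsilon\Big)^{\ell-1}.$$
   Context: The empirical CDF built from samples $X_1,\dots,X_n$ is $U_n(u)=\frac1n\sum_{i=1}^n\mathbf 1\{X_i\le u\}$. A sum $\sum_{\ell=i}^{j}$ with $i>j$ equals $0$. *)

theory Defs
  imports "HOL-Probability.Probability"
begin

definition emp_cdf :: "nat \<Rightarrow> (nat \<Rightarrow> real) \<Rightarrow> real \<Rightarrow> real" where
  "emp_cdf n x u = (1 / real n) * (\<Sum>i=1..n. of_bool (x i \<le> u))"

end

theory Submission
  imports Defs
begin

text \<open>Let \<open>N(t)\<close> be the number of samples up to \<open>t\<close> and \<open>s\<^sub>l = max (l / n + \<epsilon>) \<alpha>\<close>. By
  right-continuity of \<open>N\<close>, the deviation exceeds \<open>\<epsilon>\<close> iff \<open>N(s\<^sub>l) \<le> l\<close> for one of the finitely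
  many \<open>l\<close> with \<open>l / n + \<epsilon> < \<beta>\<close>. At the first such \<open>l\<close>, exactly \<open>l\<close> samples, say those with index
  in \<open>J\<close>, are at most \<open>s\<^sub>l\<close>, and the others are independent of the event that \<open>J\<close> satisfies the
  constraints before \<open>s\<^sub>l\<close>. If \<open>q\<^sub>l\<close> is the probability of that event, the answer is the sum of
  \<open>(n choose l) * q\<^sub>l * (1 - s\<^sub>l) ^ (n - l)\<close>, while applying the same decomposition to \<open>l\<close> samples
  that all lie below \<open>s\<^sub>l\<close> gives the recursion
  \<open>s\<^sub>l ^ l = (\<Sum>j\<le>l. (l choose j) * q\<^sub>j * (s\<^sub>l - s\<^sub>j) ^ (l - j))\<close>.
  Abel's binomial identity solves it.\<close>

subsection \<open>Abel's binomial identity\<close>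

text \<open>Pascal's rule and an index shift: a finite difference of order \<open>Suc n\<close> is
  one of order \<open>n\<close> applied to the first difference of \<open>g\<close>.\<close>

lemma alternating_binomial_sum_Suc:
  fixes g :: "nat \<Rightarrow> 'a::comm_ring_1"
  shows "(\<Sum>k\<le>Suc n. (-1) ^ k * of_nat (Suc n choose k) * g k) =
         (\<Sum>k\<le>n. (-1) ^ k * of_nat (n choose k) * (g k - g (Suc k)))"
proof -
  have "(\<Sum>k\<le>Suc n. (-1) ^ k * of_nat (Suc n choose k) * g k) =
        g 0 + (\<Sum>k\<le>n. (-1) ^ Suc k * of_nat (n choose Suc k) * g (Suc k))
            + (\<Sum>k\<le>n. (-1) ^ Suc k * of_nat (n choose k) * g (Suc k))"
    by (subst sum.atMost_Suc_shift) (simp add: sum.distrib[symmetric] algebra_simps del: sum.atMost_Suc)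
  also have "g 0 + (\<Sum>k\<le>n. (-1) ^ Suc k * of_nat (n choose Suc k) * g (Suc k)) =
        (\<Sum>k\<le>Suc n. (-1) ^ k * of_nat (n choose k) * g k)"
    by (subst sum.atMost_Suc_shift) simp
  also have "\<dots> = (\<Sum>k\<le>n. (-1) ^ k * of_nat (n choose k) * g k)"
    by (simp add: binomial_eq_0)
  finally show ?thesis
    by (simp add: sum.distrib[symmetric] algebra_simps sum_subtractf)
qed

text \<open>Finite differences of order \<open>n\<close> annihilate polynomials of degree below
  \<open>n\<close>: differencing once expands the power into lower ones, to which the induction
  hypothesis applies.\<close>

lemma alternating_binomial_sum_power:
  fixes x z :: "'a::comm_ring_1"
  assumes "m < n"
  shows "(\<Sum>k\<le>n. (-1) ^ k * of_nat (n choose k) * (x + of_nat k * z) ^ m) = 0"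
  using assms
proof (induction n arbitrary: m)
  case (Suc n)
  have step: "(x + of_nat k * z) ^ m - (x + of_nat (Suc k) * z) ^ m =
      (\<Sum>i<m. (- (of_nat (m choose i) * z ^ (m - i))) * (x + of_nat k * z) ^ i)" for k
  proof -
    have "(x + of_nat (Suc k) * z) ^ m = ((x + of_nat k * z) + z) ^ m"
      by (simp add: algebra_simps)
    also have "\<dots> = (\<Sum>i\<le>m. of_nat (m choose i) * (x + of_nat k * z) ^ i * z ^ (m - i))"
      by (rule binomial_ring)
    also have "{..m} = insert m {..<m}" by auto
    finally show ?thesis by (simp add: sum_negf algebra_simps)
  qed
  have "(\<Sum>k\<le>Suc n. (-1) ^ k * of_nat (Suc n choose k) * (x + of_nat k * z) ^ m) =
      (\<Sum>k\<le>n. \<Sum>i<m. (-1) ^ k * of_nat (n choose k) *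
          ((- (of_nat (m choose i) * z ^ (m - i))) * (x + of_nat k * z) ^ i))"
    unfolding alternating_binomial_sum_Suc step by (simp only: sum_distrib_left)
  also have "\<dots> = (\<Sum>i<m. (- (of_nat (m choose i) * z ^ (m - i))) *
          (\<Sum>k\<le>n. (-1) ^ k * of_nat (n choose k) * (x + of_nat k * z) ^ i))"
    by (subst sum.swap) (simp add: sum_distrib_left mult_ac sum_negf)
  also have "\<dots> = 0"
    using Suc by (intro sum.neutral) auto
  finally show ?case .
qed simp

text \<open>The product \<open>x * (x + k * z) ^ (k - 1)\<close>, with the value \<open>1\<close> rather than the
  junk value \<open>x\<close> at \<open>k = 0\<close>.\<close>
definition abel_poly :: "'a::comm_ring_1 \<Rightarrow> 'a \<Rightarrow> nat \<Rightarrow> 'a" where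
  "abel_poly x z k = (if k = 0 then 1 else x * (x + of_nat k * z) ^ (k - 1))"

lemma abel_poly_0 [simp]: "abel_poly x z 0 = 1"
  by (simp add: abel_poly_def)

text \<open>Both sides have the same derivative in \<open>y\<close>, and they agree at \<open>y = - x\<close>, where the
  left-hand side is an alternating binomial sum of a polynomial of degree below \<open>n\<close>.\<close>
lemma abel_binomial:
  fixes x y z :: real
  shows "(\<Sum>k\<le>n. of_nat (n choose k) * abel_poly x z k * (y - of_nat k * z) ^ (n - k)) = (x + y) ^ n"
proof (induction n arbitrary: y)
  case (Suc n)
  define f where "f y = (\<Sum>k\<le>Suc n. of_nat (Suc n choose k) * abel_poly x z k *
      (y - of_nat k * z) ^ (Suc n - k)) - (x + y) ^ Suc n" for y
  \<comment> \<open>Absorption turns the derivative of the sum of order \<open>Suc n\<close> into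
    \<open>Suc n\<close> times the sum of order \<open>n\<close>, which the induction hypothesis
    evaluates.\<close>
  have absorb: "real (Suc n choose k) * real (Suc n - k) = real (Suc n) * real (n choose k)"
    if "k \<le> n" for k
  proof -
    have "(Suc n - k) * (Suc n choose k) = Suc n * (n choose k)"
      using binomial_absorb_comp[of "Suc n" k] by simp
    then show ?thesis
      by (metis mult.commute of_nat_mult)
  qed
  have "(f has_real_derivative 0) (at y)" for y
  proof -
    have "(f has_real_derivative
       (\<Sum>k\<le>Suc n. of_nat (Suc n choose k) * abel_poly x z k *
          (of_nat (Suc n - k) * (y - of_nat k * z) ^ (Suc n - k - 1))) - of_nat (Suc n) * (x + y) ^ n) (at y)"
    proof -
      have "((\<lambda>y. c * (y - w) ^ j) has_real_derivative c * (of_nat j * (y - w) ^ (j - 1))) (at y)"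
        for c w :: real and j
        by (auto intro!: derivative_eq_intros)
      moreover have "((\<lambda>y. (x + y) ^ Suc n) has_real_derivative of_nat (Suc n) * (x + y) ^ n) (at y)"
        by (auto intro!: derivative_eq_intros simp del: power_Suc)
      ultimately show ?thesis
        unfolding f_def by (intro DERIV_diff DERIV_sum)
    qed
    also have "(\<Sum>k\<le>Suc n. of_nat (Suc n choose k) * abel_poly x z k *
          (of_nat (Suc n - k) * (y - of_nat k * z) ^ (Suc n - k - 1))) =
       (\<Sum>k\<le>n. (real (Suc n choose k) * real (Suc n - k)) * abel_poly x z k * (y - of_nat k * z) ^ (n - k))"
      by (simp add: mult_ac)
    also have "\<dots> = (\<Sum>k\<le>n. real (Suc n) * (of_nat (n choose k) * abel_poly x z k * (y - of_nat k * z) ^ (n - k)))"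
      by (intro sum.cong refl) (simp only: absorb atMost_iff mult.assoc)
    also have "\<dots> = real (Suc n) * (x + y) ^ n"
      by (simp only: sum_distrib_left[symmetric] Suc.IH)
    finally show ?thesis by simp
  qed
  then have "f y = f (- x)"
    using DERIV_isconst_all by blast
  also have "f (- x) = 0"
  proof -
    have "f (- x) = (\<Sum>k\<le>Suc n. (x * (-1) ^ Suc n) *
        ((-1) ^ k * of_nat (Suc n choose k) * (x + of_nat k * z) ^ n))"
      unfolding f_def
    proof (simp only: add.right_inverse power_0_Suc diff_zero, intro sum.cong refl)
      fix k assume k: "k \<in> {..Suc n}"
      have sign: "(-1) ^ (Suc n - k) = (-1 :: real) ^ Suc n * (-1) ^ k"
        using k by (metis atMost_iff minus_one_power_iff even_diff_nat mult_minus1 mult_minus1_right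
            minus_minus mult_1 not_less power_add even_add power_minus_odd)
      have "(- x - of_nat k * z) ^ (Suc n - k) = (-1) ^ (Suc n - k) * (x + of_nat k * z) ^ (Suc n - k)"
        by (subst power_mult_distrib[symmetric]) (simp add: algebra_simps)
      then have "of_nat (Suc n choose k) * abel_poly x z k * (- x - of_nat k * z) ^ (Suc n - k) =
          of_nat (Suc n choose k) * ((-1) ^ Suc n * (-1) ^ k) *
          (abel_poly x z k * (x + of_nat k * z) ^ (Suc n - k))"
        by (simp only: sign mult_ac)
      \<comment> \<open>The powers of \<open>x + k * z\<close> merge into the fixed exponent
        \<open>n\<close>: for \<open>k > 0\<close> since \<open>(k - 1) + (Suc n - k) = n\<close>,
        for \<open>k = 0\<close> by splitting off a factor \<open>x\<close>.\<close>
      also have "abel_poly x z k * (x + of_nat k * z) ^ (Suc n - k) = x * (x + of_nat k * z) ^ n"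
      proof (cases k)
        case (Suc j)
        then show ?thesis using k
          by (simp add: abel_poly_def mult.assoc power_add[symmetric] del: of_nat_Suc)
      qed simp
      finally show "of_nat (Suc n choose k) * abel_poly x z k * (- x - of_nat k * z) ^ (Suc n - k) =
          (x * (-1) ^ Suc n) * ((-1) ^ k * of_nat (Suc n choose k) * (x + of_nat k * z) ^ n)"
        by (simp only: mult_ac)
    qed
    then show ?thesis
      using alternating_binomial_sum_power[of n "Suc n" x z]
      by (simp only: sum_distrib_left[symmetric] lessI mult_zero_right)
  qed
  finally show ?case by (simp add: f_def)
qed simp

text \<open>With \<open>w = d + n * z\<close>, multiplying an Abel term by \<open>w\<close> gives
  \<open>(d + k * z) * w ^ (n - k)\<close>, because \<open>(d + k * z) + (n - k) * z = w\<close>.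
  The part with \<open>d\<close> is then the binomial theorem, the part linear in \<open>k\<close>
  its absorbed form, and \<open>w\<close> cancels as it is nonzero.\<close>

lemma sum_binomial_power_abel_poly:
  fixes a d z :: real
  assumes "d + of_nat n * z \<noteq> 0"
  shows "(\<Sum>k\<le>n. of_nat (n choose k) * a ^ k * abel_poly (d + of_nat k * z) z (n - k)) =
         abel_poly (a + d) z n"
proof (cases n)
  case [simp]: (Suc m)
  define w where "w = d + of_nat n * z"
  have summand: "w * abel_poly (d + of_nat k * z) z (n - k) = (d + of_nat k * z) * w ^ (n - k)"
    if "k \<le> n" for k
  proof (cases "k = n")
    case False
    with that have "n - k = Suc (n - k - 1)" by simp
    have "d + of_nat k * z + of_nat (n - k) * z = w"
      using that by (simp add: w_def of_nat_diff algebra_simps)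
    with \<open>n - k = _\<close> False that show ?thesis
      by (simp add: abel_poly_def mult_ac)
  qed (simp add: w_def)
  have absorb: "(\<Sum>k\<le>n. real k * (of_nat (n choose k) * a ^ k * w ^ (n - k))) = real n * a * (a + w) ^ m"
  proof -
    have "(\<Sum>k\<le>n. real k * (of_nat (n choose k) * a ^ k * w ^ (n - k))) =
          (\<Sum>k\<le>m. real (Suc k * (Suc m choose Suc k)) * a ^ Suc k * w ^ (m - k))"
      unfolding Suc by (subst sum.atMost_Suc_shift) (simp add: mult_ac del: binomial_Suc_Suc of_nat_Suc mult_Suc)
    also have "\<dots> = (\<Sum>k\<le>m. real n * a * (of_nat (m choose k) * a ^ k * w ^ (m - k)))"
      unfolding Suc_times_binomial by (simp add: mult_ac del: of_nat_Suc mult_Suc)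
    also have "\<dots> = real n * a * (a + w) ^ m"
      by (simp only: sum_distrib_left[symmetric] binomial_ring)
    finally show ?thesis .
  qed
  have "w * (\<Sum>k\<le>n. of_nat (n choose k) * a ^ k * abel_poly (d + of_nat k * z) z (n - k)) =
        (\<Sum>k\<le>n. of_nat (n choose k) * a ^ k * (w * abel_poly (d + of_nat k * z) z (n - k)))"
    by (simp add: sum_distrib_left mult_ac del: sum.atMost_Suc)
  also have "\<dots> = (\<Sum>k\<le>n. d * (of_nat (n choose k) * a ^ k * w ^ (n - k)) +
        z * (real k * (of_nat (n choose k) * a ^ k * w ^ (n - k))))"
    by (intro sum.cong refl, simp only: summand atMost_iff) (simp add: algebra_simps)
  also have "\<dots> = d * (a + w) ^ n + z * (real n * a * (a + w) ^ m)"
    by (simp only: sum.distrib sum_distrib_left[symmetric] absorb binomial_ring)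
  also have "\<dots> = w * ((a + d) * (a + w) ^ m)"
    unfolding w_def by (simp add: algebra_simps)
  finally show ?thesis
    using assms unfolding w_def[symmetric] by (simp add: abel_poly_def w_def add.assoc)
qed simp

text \<open>Candidate for \<open>q\<^sub>l\<close> when the thresholds are \<open>a\<close> below
  index \<open>K\<close> and \<open>a + d + l * z\<close> from \<open>K\<close> on. In the second
  case \<open>k\<close> stands for the number of points in \<open>[0, a]\<close>, at least
  \<open>K\<close>, and the Abel factor for the volume of admissible positions of the other
  \<open>l - k\<close> points above \<open>a\<close>.\<close>

definition first_passage_coeff :: "real \<Rightarrow> real \<Rightarrow> real \<Rightarrow> nat \<Rightarrow> nat \<Rightarrow> real" where
  "first_passage_coeff a d z K l =
     (if l < K then a ^ l
      else \<Sum>k=K..l. of_nat (l choose k) * a ^ k * abel_poly (d + of_nat k * z) z (l - k))"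

text \<open>After the two sums are swapped, \<open>abel_binomial\<close> collapses the sum over
  \<open>j\<close> for each \<open>k \<ge> K\<close> to one term of the binomial expansion of
  \<open>(a + (d + l * z)) ^ l\<close>; the indices \<open>j < K\<close> supply the remaining
  terms.\<close>

lemma first_passage_coeff_recursion:
  fixes a d z :: real and K :: nat
  defines "s \<equiv> \<lambda>l. if l < K then a else a + d + of_nat l * z"
  shows "(\<Sum>j\<le>l. of_nat (l choose j) * first_passage_coeff a d z K j * (s l - s j) ^ (l - j)) = s l ^ l"
proof (cases "l < K")
  case True
  \<comment> \<open>All thresholds up to index \<open>l\<close> equal \<open>a\<close> here, so only
    \<open>j = l\<close> survives, through \<open>0 ^ 0 = 1\<close>.\<close>
  have "(\<Sum>j\<le>l. of_nat (l choose j) * first_passage_coeff a d z K j * (s l - s j) ^ (l - j)) =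
        (\<Sum>j\<in>{l}. of_nat (l choose j) * first_passage_coeff a d z K j * (s l - s j) ^ (l - j))"
    using True by (intro sum.mono_neutral_right) (auto simp: s_def)
  then show ?thesis using True by (simp add: s_def first_passage_coeff_def)
next
  case False
  let ?A = "\<lambda>k j. abel_poly (d + of_nat k * z) z (j - k)"
  have inner: "(\<Sum>j=k..l. of_nat (l choose j) * (of_nat (j choose k) * a ^ k * ?A k j) * (s l - s j) ^ (l - j)) =
       of_nat (l choose k) * a ^ k * (d + of_nat l * z) ^ (l - k)" if "k \<in> {K..l}" for k
  proof -
    \<comment> \<open>Trinomial revision and the shift \<open>i = j - k\<close> produce Abel's
      identity with \<open>x = d + k * z\<close> and \<open>y = (l - k) * z\<close>.\<close>
    have "(\<Sum>j=k..l. of_nat (l choose j) * (of_nat (j choose k) * a ^ k * ?A k j) * (s l - s j) ^ (l - j)) =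
          (\<Sum>i\<le>l - k. of_nat (l choose k) * a ^ k * (of_nat ((l - k) choose i) *
             abel_poly (d + of_nat k * z) z i * (of_nat (l - k) * z - of_nat i * z) ^ (l - k - i)))"
    proof (rule sum.reindex_bij_witness[where i = "\<lambda>i. i + k" and j = "\<lambda>j. j - k"])
      fix j assume j: "j \<in> {k..l}"
      have "(l choose j) * (j choose k) = (l choose k) * ((l - k) choose (j - k))"
        using j by (intro choose_mult) auto
      then have "real (l choose j) * real (j choose k) = real (l choose k) * real ((l - k) choose (j - k))"
        by (metis of_nat_mult)
      moreover have "s l - s j = of_nat (l - k) * z - of_nat (j - k) * z"
        using j that False by (auto simp: s_def of_nat_diff algebra_simps)
      moreover have "l - k - (j - k) = l - j" using j by auto
      ultimately show "of_nat (l choose k) * a ^ k * (of_nat ((l - k) choose (j - k)) *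
             abel_poly (d + of_nat k * z) z (j - k) * (of_nat (l - k) * z - of_nat (j - k) * z) ^ (l - k - (j - k))) =
          of_nat (l choose j) * (of_nat (j choose k) * a ^ k * ?A k j) * (s l - s j) ^ (l - j)"
        by (simp add: mult_ac)
    qed (use that in auto)
    also have "\<dots> = of_nat (l choose k) * a ^ k * (d + of_nat k * z + of_nat (l - k) * z) ^ (l - k)"
      by (simp only: sum_distrib_left[symmetric] abel_binomial)
    also have "d + of_nat k * z + of_nat (l - k) * z = d + of_nat l * z"
      using that by (simp add: of_nat_diff algebra_simps)
    finally show ?thesis .
  qed
  have split: "{..l} = {..<K} \<union> {K..l}" using False by auto
  have "(\<Sum>j\<le>l. of_nat (l choose j) * first_passage_coeff a d z K j * (s l - s j) ^ (l - j)) =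
        (\<Sum>j<K. of_nat (l choose j) * a ^ j * (d + of_nat l * z) ^ (l - j)) +
        (\<Sum>j=K..l. \<Sum>k=K..j. of_nat (l choose j) * (of_nat (j choose k) * a ^ k * ?A k j) * (s l - s j) ^ (l - j))"
    unfolding split using False
    by (subst sum.union_disjoint)
      (auto simp: first_passage_coeff_def s_def sum_distrib_left sum_distrib_right mult_ac intro!: sum.cong)
  also have "(\<Sum>j=K..l. \<Sum>k=K..j. of_nat (l choose j) * (of_nat (j choose k) * a ^ k * ?A k j) * (s l - s j) ^ (l - j)) =
        (\<Sum>k=K..l. \<Sum>j=k..l. of_nat (l choose j) * (of_nat (j choose k) * a ^ k * ?A k j) * (s l - s j) ^ (l - j))"
    unfolding sum.Sigma[OF finite_atLeastAtMost ballI[OF finite_atLeastAtMost]]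
    by (rule sum.reindex_bij_witness[where i = "\<lambda>(k, j). (j, k)" and j = "\<lambda>(j, k). (k, j)"]) auto
  also have "\<dots> = (\<Sum>k=K..l. of_nat (l choose k) * a ^ k * (d + of_nat l * z) ^ (l - k))"
    by (intro sum.cong refl inner)
  also have "(\<Sum>j<K. of_nat (l choose j) * a ^ j * (d + of_nat l * z) ^ (l - j)) + \<dots> =
        (\<Sum>j\<le>l. of_nat (l choose j) * a ^ j * (d + of_nat l * z) ^ (l - j))"
    unfolding split by (subst sum.union_disjoint) auto
  also have "\<dots> = (a + (d + of_nat l * z)) ^ l"
    by (rule binomial_ring[symmetric])
  finally show ?thesis using False by (simp add: s_def add.assoc)
qed

subsection \<open>First passage of the counting function\<close>

lemma sum_subsets_card:
  fixes f :: "nat \<Rightarrow> 'b::comm_semiring_1"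
  assumes "finite I"
  shows "(\<Sum>J | J \<subseteq> I \<and> card J < L. f (card J)) = (\<Sum>l<L. of_nat (card I choose l) * f l)"
proof -
  have fin: "finite {J. J \<subseteq> I \<and> card J < L}"
    using assms by simp
  have "(\<Sum>J | J \<subseteq> I \<and> card J < L. f (card J)) =
        (\<Sum>l<L. \<Sum>J \<in> {J \<in> {J. J \<subseteq> I \<and> card J < L}. card J = l}. f (card J))"
    by (rule sum.group[symmetric]) (use fin in auto)
  also have "\<dots> = (\<Sum>l<L. of_nat (card I choose l) * f l)"
  proof (intro sum.cong refl)
    fix l assume "l \<in> {..<L}"
    then have "{J \<in> {J. J \<subseteq> I \<and> card J < L}. card J = l} = {J. J \<subseteq> I \<and> card J = l}"
      by auto
    then show "(\<Sum>J \<in> {J \<in> {J. J \<subseteq> I \<and> card J < L}. card J = l}. f (card J)) = of_nat (card I choose l) * f l"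
      using n_subsets[OF assms, of l] by simp
  qed
  finally show ?thesis .
qed

definition points_upto :: "'i set \<Rightarrow> ('i \<Rightarrow> real) \<Rightarrow> real \<Rightarrow> nat" where
  "points_upto I x t = card {i\<in>I. x i \<le> t}"

text \<open>The points of \<open>J\<close> are exactly those that have been seen when the counting function
  first fails to exceed its index, which happens at the threshold \<open>s (card J)\<close>.\<close>
definition first_passage :: "(nat \<Rightarrow> real) \<Rightarrow> 'i set \<Rightarrow> ('i \<Rightarrow> real) \<Rightarrow> bool" where
  "first_passage s J x \<longleftrightarrow>
     (\<forall>i\<in>J. x i \<le> s (card J)) \<and> (\<forall>k<card J. k < points_upto J x (s k))"

lemma points_upto_mono: "finite I \<Longrightarrow> s \<le> t \<Longrightarrow> points_upto I x s \<le> points_upto I x t"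
  unfolding points_upto_def by (intro card_mono) auto

lemma first_passage_seen:
  assumes "J \<subseteq> I" "first_passage s J x" "\<forall>i\<in>I - J. s (card J) < x i"
  shows "{i\<in>I. x i \<le> s (card J)} = J"
  using assms unfolding first_passage_def by (force simp: not_le[symmetric])

text \<open>\<open>J\<close> consists of the points up to \<open>s j\<close> for the least
  \<open>j\<close> with \<open>points_upto I x (s j) \<le> j\<close>. The cap \<open>T\<close>
  allows two uses: \<open>T = 1\<close> for the whole sample and \<open>T = s l\<close> for the
  recursion.\<close>

lemma first_passage_partition:
  assumes I: "finite I" and s: "mono s" and T: "\<And>l. l < L \<Longrightarrow> s l \<le> T"
  shows "((\<forall>i\<in>I. x i \<le> T) \<and> (\<exists>l<L. points_upto I x (s l) \<le> l)) \<longleftrightarrow>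
         (\<exists>J. J \<subseteq> I \<and> card J < L \<and> first_passage s J x \<and> (\<forall>i\<in>I - J. x i \<in> {s (card J)<..T}))"
    (is "?lhs \<longleftrightarrow> ?rhs")
proof
  assume ?lhs
  then have le_T: "\<forall>i\<in>I. x i \<le> T" and ex: "\<exists>l<L. points_upto I x (s l) \<le> l" by auto
  define j where "j = (LEAST l. points_upto I x (s l) \<le> l)"
  have j: "points_upto I x (s j) \<le> j" and jL: "j < L"
    using ex unfolding j_def by (auto intro: LeastI Least_le[THEN le_less_trans])
  have less: "k < points_upto I x (s k)" if "k < j" for k
    using not_less_Least[of k] that unfolding j_def by (meson not_le)
  define J where "J = {i\<in>I. x i \<le> s j}"
  have card_J: "card J = points_upto I x (s j)"
    by (simp add: J_def points_upto_def)
  \<comment> \<open>Minimality at \<open>j - 1\<close> gives at least \<open>j\<close> points up to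
    \<open>s (j - 1)\<close>, hence up to \<open>s j\<close>; so the count at the first failure is
    exactly \<open>j\<close>.\<close>
  moreover have "j \<le> points_upto I x (s j)"
  proof (cases j)
    case (Suc k)
    then have "Suc k \<le> points_upto I x (s k)" using less[of k] by simp
    also have "\<dots> \<le> points_upto I x (s j)"
      using Suc I s by (intro points_upto_mono) (auto simp: mono_def)
    finally show ?thesis using Suc by simp
  qed simp
  ultimately have [simp]: "card J = j" using j by simp
  have "points_upto J x (s k) = points_upto I x (s k)" if "k < j" for k
  proof -
    have "s k \<le> s j" using s that by (auto simp: mono_def)
    then have "{i\<in>J. x i \<le> s k} = {i\<in>I. x i \<le> s k}" by (auto simp: J_def)
    then show ?thesis by (simp add: points_upto_def)
  qed
  moreover have "\<forall>i\<in>J. x i \<le> s j" by (simp add: J_def)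
  ultimately have "first_passage s J x"
    using less by (simp add: first_passage_def)
  moreover have "J \<subseteq> I" "\<forall>i\<in>I - J. s j < x i"
    by (auto simp: J_def)
  ultimately show ?rhs
    using jL le_T by (intro exI[of _ J]) simp
next
  assume ?rhs
  then obtain J where J: "J \<subseteq> I" "card J < L" "first_passage s J x"
      "\<forall>i\<in>I - J. x i \<in> {s (card J)<..T}"
    by blast
  then have "{i\<in>I. x i \<le> s (card J)} = J"
    by (intro first_passage_seen) auto
  then have "points_upto I x (s (card J)) \<le> card J"
    by (simp add: points_upto_def)
  moreover have "x i \<le> T" if "i \<in> I" for i
  proof (cases "i \<in> J")
    case True
    then have "x i \<le> s (card J)" using J by (simp add: first_passage_def)
    also have "\<dots> \<le> T" using J T by simp
    finally show ?thesis .
  qed (use that J in auto)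
  ultimately show ?lhs using J by blast
qed

text \<open>If \<open>card A < card B\<close>, then \<open>B\<close> demands more than
  \<open>card A\<close> points up to \<open>s (card A)\<close>, whereas only those of
  \<open>A\<close> lie there. Equal cardinalities give the same threshold, and the points seen there
  determine the set.\<close>

lemma first_passage_unique:
  assumes I: "finite I"
    and J: "J \<subseteq> I" "first_passage s J x" "\<forall>i\<in>I - J. s (card J) < x i"
    and J': "J' \<subseteq> I" "first_passage s J' x" "\<forall>i\<in>I - J'. s (card J') < x i"
  shows "J = J'"
proof -
  have not_less: "\<not> card A < card B"
    if A: "A \<subseteq> I" "first_passage s A x" "\<forall>i\<in>I - A. s (card A) < x i"
      and B: "B \<subseteq> I" "first_passage s B x" for A B
  proof
    assume "card A < card B"
    then have "card A < points_upto B x (s (card A))"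
      using B by (simp add: first_passage_def)
    also have "\<dots> \<le> card {i\<in>I. x i \<le> s (card A)}"
      unfolding points_upto_def by (rule card_mono) (use I B(1) in auto)
    also have "\<dots> = card A" by (simp only: first_passage_seen[OF A])
    finally show False by simp
  qed
  have "card J = card J'"
    using not_less[OF J J'(1,2)] not_less[OF J' J(1,2)] by simp
  then show ?thesis
    using first_passage_seen[OF J] first_passage_seen[OF J'] by metis
qed

lemma measurable_first_passage [measurable]:
  assumes "finite J"
  shows "Measurable.pred (\<Pi>\<^sub>M i\<in>J. borel) (first_passage s J)"
proof -
  have [measurable]: "(\<lambda>x. points_upto J x t) \<in> measurable (\<Pi>\<^sub>M i\<in>J. borel) (count_space UNIV)" for t
  proof -
    have "points_upto J x t = (\<Sum>i\<in>J. if x i \<le> t then 1 else 0)" for x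
      unfolding points_upto_def using assms by (simp add: sum.If_cases Int_def)
    then show ?thesis by (simp only:) measurable
  qed
  show ?thesis
    unfolding first_passage_def using assms by measurable
qed

text \<open>The event depends only on the coordinates in \<open>J\<close>, as the independence
  argument requires.\<close>

lemma first_passage_restrict [simp]: "first_passage s J (restrict x J) = first_passage s J x"
proof -
  have "{i\<in>J. restrict x J i \<le> t} = {i\<in>J. x i \<le> t}" for t by auto
  then show ?thesis by (simp add: first_passage_def points_upto_def)
qed

section \<open>First-passage probabilities for independent uniform samples\<close>

locale uniform_sample = prob_space +
  fixes X :: "'i \<Rightarrow> 'a \<Rightarrow> real" and S :: "'i set"
  assumes finite_S: "finite S"
    and indep: "indep_vars (\<lambda>_. borel) X S"
    and uniform: "\<And>i. i \<in> S \<Longrightarrow> distr M borel (X i) = uniform_measure lborel {0..1}"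
begin

lemma measurable_X [measurable]: "i \<in> S \<Longrightarrow> X i \<in> borel_measurable M"
  using indep by (auto simp: indep_vars_def)

lemma prob_X:
  assumes "i \<in> S" "B \<in> sets borel"
  shows "\<P>(\<omega> in M. X i \<omega> \<in> B) = measure lborel ({0..1} \<inter> B)"
proof -
  have "\<P>(\<omega> in M. X i \<omega> \<in> B) = measure (distr M borel (X i)) B"
    using assms by (subst measure_distr) (auto intro!: arg_cong[where f = prob])
  also have "\<dots> = measure lborel ({0..1} \<inter> B)"
    using assms by (simp add: uniform)
  finally show ?thesis .
qed

lemma prob_X_Ioc:
  assumes "i \<in> S" "0 \<le> a" "a \<le> b" "b \<le> 1"
  shows "\<P>(\<omega> in M. X i \<omega> \<in> {a<..b}) = b - a"
proof -
  have "{0..1} \<inter> {a<..b} = {a<..b}" using assms by auto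
  then show ?thesis using prob_X[OF assms(1), of "{a<..b}"] assms by simp
qed

lemma prob_X_le:
  assumes "i \<in> S" "0 \<le> b" "b \<le> 1"
  shows "\<P>(\<omega> in M. X i \<omega> \<le> b) = b"
proof -
  have "{0..1} \<inter> {..b} = {0..b}" using assms by auto
  then show ?thesis using prob_X[OF assms(1), of "{..b}"] assms by simp
qed

lemma prob_all:
  assumes "K \<subseteq> S" "\<And>i. i \<in> K \<Longrightarrow> B i \<in> sets borel"
  shows "\<P>(\<omega> in M. \<forall>i\<in>K. X i \<omega> \<in> B i) = (\<Prod>i\<in>K. \<P>(\<omega> in M. X i \<omega> \<in> B i))"
proof (cases "K = {}")
  case False
  have "finite K" using assms finite_S finite_subset by blast
  have "{\<omega>\<in>space M. \<forall>i\<in>K. X i \<omega> \<in> B i} = (\<Inter>i\<in>K. X i -` B i \<inter> space M)"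
    using False by auto
  moreover have "prob (\<Inter>i\<in>K. X i -` B i \<inter> space M) = (\<Prod>i\<in>K. prob (X i -` B i \<inter> space M))"
    using False assms \<open>finite K\<close> by (intro indep_varsD_finite[where M' = "\<lambda>_. borel"] indep_vars_subset[OF indep]) auto
  moreover have "X i -` B i \<inter> space M = {\<omega>\<in>space M. X i \<omega> \<in> B i}" for i by auto
  ultimately show ?thesis by simp
qed (simp add: prob_space)

lemma prob_restrict_conj:
  assumes JK: "J \<inter> K = {}" "J \<subseteq> S" "K \<subseteq> S"
    and P: "Measurable.pred (\<Pi>\<^sub>M i\<in>J. borel) P"
    and B: "\<And>i. i \<in> K \<Longrightarrow> B i \<in> sets borel"
  shows "\<P>(\<omega> in M. P (\<lambda>i\<in>J. X i \<omega>) \<and> (\<forall>i\<in>K. X i \<omega> \<in> B i)) =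
         \<P>(\<omega> in M. P (\<lambda>i\<in>J. X i \<omega>)) * (\<Prod>i\<in>K. \<P>(\<omega> in M. X i \<omega> \<in> B i))"
proof -
  let ?J = "\<Pi>\<^sub>M i\<in>J. borel :: real measure" and ?K = "\<Pi>\<^sub>M i\<in>K. borel :: real measure"
  have fin: "finite K" using JK finite_S finite_subset by blast
  have XJ: "(\<lambda>\<omega>. \<lambda>i\<in>J. X i \<omega>) \<in> measurable M ?J"
    using JK by (intro measurable_restrict) auto
  have "prob ((\<lambda>\<omega>. (\<lambda>i\<in>J. X i \<omega>, \<lambda>i\<in>K. X i \<omega>)) -` ({x\<in>space ?J. P x} \<times> (\<Pi>\<^sub>E i\<in>K. B i)) \<inter> space M) =
        prob ((\<lambda>\<omega>. \<lambda>i\<in>J. X i \<omega>) -` {x\<in>space ?J. P x} \<inter> space M) *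
        prob ((\<lambda>\<omega>. \<lambda>i\<in>K. X i \<omega>) -` (\<Pi>\<^sub>E i\<in>K. B i) \<inter> space M)"
    using P B fin by (intro indep_varD[OF indep_var_restrict[OF indep JK]]) (auto intro!: sets_PiM_I_finite)
  moreover have "(\<lambda>\<omega>. (\<lambda>i\<in>J. X i \<omega>, \<lambda>i\<in>K. X i \<omega>)) -` ({x\<in>space ?J. P x} \<times> (\<Pi>\<^sub>E i\<in>K. B i)) \<inter> space M =
      {\<omega>\<in>space M. P (\<lambda>i\<in>J. X i \<omega>) \<and> (\<forall>i\<in>K. X i \<omega> \<in> B i)}"
    using measurable_space[OF XJ] by (auto simp: PiE_iff)
  moreover have "(\<lambda>\<omega>. \<lambda>i\<in>J. X i \<omega>) -` {x\<in>space ?J. P x} \<inter> space M = {\<omega>\<in>space M. P (\<lambda>i\<in>J. X i \<omega>)}"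
    using measurable_space[OF XJ] by auto
  moreover have "(\<lambda>\<omega>. \<lambda>i\<in>K. X i \<omega>) -` (\<Pi>\<^sub>E i\<in>K. B i) \<inter> space M = {\<omega>\<in>space M. \<forall>i\<in>K. X i \<omega> \<in> B i}"
    by (auto simp: PiE_iff)
  ultimately show ?thesis using prob_all[OF JK(3) B] by simp
qed

text \<open>The events of \<open>first_passage_partition\<close> are disjoint by
  \<open>first_passage_unique\<close>. For each \<open>J\<close>, the passage condition is
  independent of the samples outside \<open>J\<close>, each of which falls into
  \<open>(s (card J), T]\<close> with probability \<open>T - s (card J)\<close>.\<close>

lemma prob_passage:
  assumes I: "I \<subseteq> S" and s: "mono s" "\<And>l. 0 \<le> s l" and T: "\<And>l. l < L \<Longrightarrow> s l \<le> T" "T \<le> 1"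
  shows "\<P>(\<omega> in M. (\<forall>i\<in>I. X i \<omega> \<le> T) \<and> (\<exists>l<L. points_upto I (\<lambda>i. X i \<omega>) (s l) \<le> l)) =
    (\<Sum>J | J \<subseteq> I \<and> card J < L.
       \<P>(\<omega> in M. first_passage s J (\<lambda>i. X i \<omega>)) * (T - s (card J)) ^ (card I - card J))"
proof -
  have finI: "finite I" using I finite_S finite_subset by blast
  let ?\<J> = "{J. J \<subseteq> I \<and> card J < L}"
  let ?E = "\<lambda>J. {\<omega>\<in>space M. first_passage s J (\<lambda>i\<in>J. X i \<omega>) \<and> (\<forall>i\<in>I - J. X i \<omega> \<in> {s (card J)<..T})}"
  have sets_E: "?E J \<in> events" if "J \<in> ?\<J>" for J
  proof -
    have J: "J \<subseteq> S" "finite J" using that I finI finite_subset[of J I] by auto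
    have "(\<lambda>\<omega>. \<lambda>i\<in>J. X i \<omega>) \<in> measurable M (\<Pi>\<^sub>M i\<in>J. borel)"
      using J by (intro measurable_restrict) auto
    then have "{\<omega>\<in>space M. first_passage s J (\<lambda>i\<in>J. X i \<omega>)} \<in> events"
      using measurable_first_passage[OF J(2)] by (rule predE[OF measurable_compose])
    moreover have "{\<omega>\<in>space M. X i \<omega> \<in> {s (card J)<..T}} \<in> events" if "i \<in> I - J" for i
    proof -
      have [measurable]: "X i \<in> borel_measurable M" using I that by auto
      show ?thesis by measurable
    qed
    then have "{\<omega>\<in>space M. \<forall>i\<in>I - J. X i \<omega> \<in> {s (card J)<..T}} \<in> events"
      using finI by (intro sets.sets_Collect_finite_All) auto
    ultimately show ?thesis
      by (intro sets.sets_Collect_conj)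
  qed
  have "{\<omega>\<in>space M. (\<forall>i\<in>I. X i \<omega> \<le> T) \<and> (\<exists>l<L. points_upto I (\<lambda>i. X i \<omega>) (s l) \<le> l)} = (\<Union>J\<in>?\<J>. ?E J)"
    using first_passage_partition[OF finI s(1) T(1)] by auto
  moreover have "prob (\<Union>J\<in>?\<J>. ?E J) = (\<Sum>J\<in>?\<J>. prob (?E J))"
  proof (rule finite_measure_finite_Union)
    show "disjoint_family_on ?E ?\<J>"
    unfolding disjoint_family_on_def
    proof (intro ballI impI)
      fix J J' assume "J \<in> ?\<J>" "J' \<in> ?\<J>" "J \<noteq> J'"
      then have "\<omega> \<notin> ?E J \<inter> ?E J'" for \<omega>
        using first_passage_unique[OF finI, of J s "\<lambda>i. X i \<omega>" J'] by auto
      then show "?E J \<inter> ?E J' = {}" by blast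
    qed
  qed (use finI sets_E in auto)
  moreover have "prob (?E J) =
      \<P>(\<omega> in M. first_passage s J (\<lambda>i. X i \<omega>)) * (T - s (card J)) ^ (card I - card J)" if "J \<in> ?\<J>" for J
  proof -
    have J: "J \<subseteq> S" "I - J \<subseteq> S" "finite J" "J \<subseteq> I"
      using that I finI finite_subset[of J I] by auto
    have "prob (?E J) = \<P>(\<omega> in M. first_passage s J (\<lambda>i\<in>J. X i \<omega>)) *
        (\<Prod>i\<in>I - J. \<P>(\<omega> in M. X i \<omega> \<in> {s (card J)<..T}))"
      using J by (intro prob_restrict_conj measurable_first_passage) auto
    also have "(\<Prod>i\<in>I - J. \<P>(\<omega> in M. X i \<omega> \<in> {s (card J)<..T})) = (\<Prod>i\<in>I - J. T - s (card J))"
      using J that s T by (intro prod.cong refl prob_X_Ioc) auto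
    finally show ?thesis using J by (simp only: first_passage_restrict prod_constant card_Diff_subset)
  qed
  ultimately show ?thesis by simp
qed

text \<open>Comparing the partition of the event that all points of \<open>J\<close> lie below \<open>s (card J)\<close>
  with the assumed recursion determines the probabilities by induction on \<open>card J\<close>.\<close>
lemma prob_first_passage:
  assumes s: "mono s" "\<And>l. 0 \<le> s l"
    and q: "\<And>l. (\<Sum>j\<le>l. real (l choose j) * q j * (s l - s j) ^ (l - j)) = s l ^ l"
    and J: "J \<subseteq> S" "s (card J) \<le> 1"
  shows "\<P>(\<omega> in M. first_passage s J (\<lambda>i. X i \<omega>)) = q (card J)"
  using J
proof (induction "card J" arbitrary: J rule: less_induct)
  case less
  have fin: "finite J" using less.prems finite_S finite_subset by blast
  define l where "l = card J"
  let ?g = "\<lambda>J. \<P>(\<omega> in M. first_passage s J (\<lambda>i. X i \<omega>))"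
  let ?c = "\<lambda>k. (s l - s k) ^ (l - k)"
  have "s l ^ l = \<P>(\<omega> in M. \<forall>i\<in>J. X i \<omega> \<in> {..s l})"
    using less.prems s by (subst prob_all) (auto simp: l_def prob_X_le subset_eq)
  \<comment> \<open>The existential holds for free at \<open>k = l\<close>, as \<open>J\<close> has
    only \<open>l\<close> points; it brings the event into the form of \<open>prob_passage\<close>
    with \<open>T = s l\<close>.\<close>
  also have "\<dots> = \<P>(\<omega> in M. (\<forall>i\<in>J. X i \<omega> \<le> s l) \<and> (\<exists>k<Suc l. points_upto J (\<lambda>i. X i \<omega>) (s k) \<le> k))"
  proof -
    have "points_upto J x (s l) \<le> l" for x
      unfolding points_upto_def l_def using fin by (intro card_mono) auto
    then show ?thesis by (auto intro!: arg_cong[where f = prob])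
  qed
  also have "\<dots> = (\<Sum>K | K \<subseteq> J \<and> card K < Suc l. ?g K * ?c (card K))"
    unfolding l_def using less.prems s by (intro prob_passage) (auto simp: mono_def)
  \<comment> \<open>\<open>J\<close> is its own only subset of size \<open>l\<close>, and its factor
    is \<open>0 ^ 0 = 1\<close>. This isolates the unknown probability; smaller subsets fall under
    the induction hypothesis.\<close>
  also have "{K. K \<subseteq> J \<and> card K < Suc l} = insert J {K. K \<subseteq> J \<and> card K < l}"
  proof -
    have "K = J" if "K \<subseteq> J" "card K = l" for K
      using that fin by (simp add: card_subset_eq l_def)
    then show ?thesis by (auto simp: less_Suc_eq l_def)
  qed
  also have "(\<Sum>K\<in>\<dots>. ?g K * ?c (card K)) = ?g J + (\<Sum>K | K \<subseteq> J \<and> card K < l. ?g K * ?c (card K))"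
    using fin by (subst sum.insert) (auto simp: l_def)
  also have "(\<Sum>K | K \<subseteq> J \<and> card K < l. ?g K * ?c (card K)) =
      (\<Sum>K | K \<subseteq> J \<and> card K < l. q (card K) * ?c (card K))"
  proof (intro sum.cong refl)
    fix K assume K: "K \<in> {K. K \<subseteq> J \<and> card K < l}"
    then have "s (card K) \<le> s (card J)" using s(1) by (auto simp: l_def mono_def)
    with K less.prems have "?g K = q (card K)"
      by (intro less.hyps) (auto simp: l_def)
    then show "?g K * ?c (card K) = q (card K) * ?c (card K)" by simp
  qed
  also have "\<dots> = (\<Sum>k<l. real (l choose k) * q k * ?c k)"
    using sum_subsets_card[OF fin, where L = l and f = "\<lambda>k. q k * ?c k"] by (simp add: l_def mult.assoc)
  also have "\<dots> = s l ^ l - q l"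
    using q[of l] by (simp add: lessThan_Suc_atMost[symmetric])
  finally show ?case by (simp add: l_def)
qed

text \<open>Almost surely all samples are at most \<open>1\<close>, so \<open>prob_passage\<close>
  applies with \<open>T = 1\<close>.\<close>

lemma prob_ex_points_upto_le:
  assumes s: "mono s" "\<And>l. 0 \<le> s l"
    and q: "\<And>l. (\<Sum>j\<le>l. real (l choose j) * q j * (s l - s j) ^ (l - j)) = s l ^ l"
    and le_1: "\<And>l. l < L \<Longrightarrow> s l \<le> 1"
  shows "\<P>(\<omega> in M. \<exists>l<L. points_upto S (\<lambda>i. X i \<omega>) (s l) \<le> l) =
    (\<Sum>l<L. real (card S choose l) * q l * (1 - s l) ^ (card S - l))"
proof -
  have [measurable]: "(\<lambda>\<omega>. points_upto S (\<lambda>i. X i \<omega>) t) \<in> measurable M (count_space UNIV)" for t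
  proof -
    have "points_upto S (\<lambda>i. X i \<omega>) t = (\<Sum>i\<in>S. if X i \<omega> \<le> t then 1 else 0)" for \<omega>
      unfolding points_upto_def using finite_S by (simp add: sum.If_cases Int_def)
    then show ?thesis by (simp only:) measurable
  qed
  have "AE \<omega> in M. X i \<omega> \<le> 1" if "i \<in> S" for i
    using prob_X_le[of i 1] that by (subst prob_Collect_eq_1[symmetric]) auto
  then have "AE \<omega> in M. \<forall>i\<in>S. X i \<omega> \<le> 1"
    using finite_S by (intro AE_finite_allI) auto
  then have "\<P>(\<omega> in M. \<exists>l<L. points_upto S (\<lambda>i. X i \<omega>) (s l) \<le> l) =
      \<P>(\<omega> in M. (\<forall>i\<in>S. X i \<omega> \<le> 1) \<and> (\<exists>l<L. points_upto S (\<lambda>i. X i \<omega>) (s l) \<le> l))"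
    using finite_S by (intro measure_eq_AE) auto
  also have "\<dots> = (\<Sum>J | J \<subseteq> S \<and> card J < L.
       \<P>(\<omega> in M. first_passage s J (\<lambda>i. X i \<omega>)) * (1 - s (card J)) ^ (card S - card J))"
    using s le_1 by (intro prob_passage) auto
  also have "\<dots> = (\<Sum>J | J \<subseteq> S \<and> card J < L. q (card J) * (1 - s (card J)) ^ (card S - card J))"
    by (intro sum.cong refl arg_cong2[where f = times] prob_first_passage[OF s q]) (auto intro: le_1)
  also have "\<dots> = (\<Sum>l<L. real (card S choose l) * q l * (1 - s l) ^ (card S - l))"
    using sum_subsets_card[OF finite_S, where L = L and f = "\<lambda>l. q l * (1 - s l) ^ (card S - l)"] by (simp add: mult.assoc)
  finally show ?thesis .
qed

end

subsection \<open>The empirical distribution function\<close>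

lemma emp_cdf_eq: "emp_cdf n x u = real (points_upto {1..n} x u) / real n"
  by (simp add: emp_cdf_def points_upto_def of_bool_def sum.If_cases Int_def)

text \<open>With \<open>m\<close> the nearest sample point beyond \<open>t\<close>, capped by
  \<open>b\<close>, the count is constant on \<open>[t, m)\<close>.\<close>

lemma points_upto_right_constant:
  assumes "finite I" "t < b"
  obtains u where "t < u" "u \<le> b" "points_upto I x u = points_upto I x t"
proof -
  define m where "m = Min (insert b (x ` {i\<in>I. t < x i}))"
  have "t < m"
    using assms unfolding m_def by (subst Min_gr_iff) auto
  then obtain u where u: "t < u" "u < m"
    using dense by blast
  have "m \<le> b" and m: "m \<le> x i" if "i \<in> I" "t < x i" for i
    using assms that unfolding m_def by (auto intro!: Min_le)
  have "m \<le> b"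
    using assms unfolding m_def by (intro Min_le) auto
  have "{i\<in>I. x i \<le> u} = {i\<in>I. x i \<le> t}"
    using u m by force
  then show ?thesis
    using that[of u] u \<open>m \<le> b\<close> by (simp add: points_upto_def)
qed

text \<open>For the value \<open>l\<close> of the counting function, the deviation exceeds \<open>\<epsilon>\<close> exactly to the
  right of \<open>l / n + \<epsilon>\<close>; right-continuity reduces the supremum to these finitely many points.\<close>
lemma SUP_deviation_greater_iff:
  fixes x :: "nat \<Rightarrow> real" and U :: "real \<Rightarrow> real"
  assumes n: "n \<ge> 1" and \<alpha>\<beta>: "\<alpha> \<le> \<beta>"
    and U: "\<And>u. u \<in> {\<alpha>..\<beta>} \<Longrightarrow> U u = u"
  shows "(SUP u\<in>{\<alpha>..\<beta>}. U u - emp_cdf n x u) > \<epsilon> \<longleftrightarrow>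
    (\<exists>l<nat \<lceil>real n * (\<beta> - \<epsilon>)\<rceil>. points_upto {1..n} x (max (real l / real n + \<epsilon>) \<alpha>) \<le> l)"
    (is "_ \<longleftrightarrow> ?rhs")
proof -
  let ?N = "points_upto {1..n} x"
  \<comment> \<open>For an integer \<open>l\<close>, being below a ceiling is the same as being
    strictly below the real number itself; if \<open>\<beta> \<le> \<epsilon>\<close>, both sides
    are false.\<close>
  have less_iff: "l < nat \<lceil>real n * (\<beta> - \<epsilon>)\<rceil> \<longleftrightarrow> real l / real n + \<epsilon> < \<beta>" for l
  proof -
    have "l < nat \<lceil>real n * (\<beta> - \<epsilon>)\<rceil> \<longleftrightarrow> real l < real n * (\<beta> - \<epsilon>)"
      by (simp add: zless_nat_eq_int_zless less_ceiling_iff)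
    also have "\<dots> \<longleftrightarrow> real l / real n + \<epsilon> < \<beta>"
      using n by (simp add: field_simps)
    finally show ?thesis .
  qed
  have exceed_iff: "\<epsilon> < u - emp_cdf n x u \<longleftrightarrow> real (?N u) / real n + \<epsilon> < u" for u
    by (auto simp: emp_cdf_eq)
  have "(SUP u\<in>{\<alpha>..\<beta>}. U u - emp_cdf n x u) = (SUP u\<in>{\<alpha>..\<beta>}. u - emp_cdf n x u)"
    using U by (intro SUP_cong) auto
  \<comment> \<open>Boundedness lets the strict inequality pass from the supremum to a single
    \<open>u\<close>.\<close>
  moreover have "bdd_above ((\<lambda>u. u - emp_cdf n x u) ` {\<alpha>..\<beta>})"
  proof (rule bdd_aboveI2)
    show "u - emp_cdf n x u \<le> \<beta>" if "u \<in> {\<alpha>..\<beta>}" for u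
    proof -
      have "0 \<le> emp_cdf n x u" by (simp add: emp_cdf_eq)
      then show ?thesis using that by simp
    qed
  qed
  ultimately have "(SUP u\<in>{\<alpha>..\<beta>}. U u - emp_cdf n x u) > \<epsilon> \<longleftrightarrow>
      (\<exists>u\<in>{\<alpha>..\<beta>}. real (?N u) / real n + \<epsilon> < u)"
    using \<alpha>\<beta> by (simp add: less_cSUP_iff exceed_iff)
  also have "\<dots> \<longleftrightarrow> ?rhs"
  proof
    assume "\<exists>u\<in>{\<alpha>..\<beta>}. real (?N u) / real n + \<epsilon> < u"
    then obtain u where u: "\<alpha> \<le> u" "u \<le> \<beta>" "real (?N u) / real n + \<epsilon> < u" by auto
    \<comment> \<open>The index sought is the count at \<open>u\<close> itself, whose threshold does
      not exceed \<open>u\<close>.\<close>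
    have "?N (max (real (?N u) / real n + \<epsilon>) \<alpha>) \<le> ?N u"
      using u by (intro points_upto_mono) auto
    moreover have "?N u < nat \<lceil>real n * (\<beta> - \<epsilon>)\<rceil>"
      unfolding less_iff using u by linarith
    ultimately show ?rhs by blast
  next
    assume ?rhs
    then obtain l where l: "real l / real n + \<epsilon> < \<beta>" "?N (max (real l / real n + \<epsilon>) \<alpha>) \<le> l"
      unfolding less_iff by blast
    \<comment> \<open>If \<open>l / n + \<epsilon> < \<alpha>\<close>, then
      \<open>u = \<alpha>\<close> works; otherwise strictness requires moving slightly to the right
      without catching a new sample.\<close>
    obtain u where u: "u \<in> {\<alpha>..\<beta>}" "real l / real n + \<epsilon> < u" "?N u \<le> l"
    proof (cases "real l / real n + \<epsilon> < \<alpha>")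
      case True
      then show ?thesis using l \<alpha>\<beta> that[of \<alpha>] by simp
    next
      case False
      obtain u where "real l / real n + \<epsilon> < u" "u \<le> \<beta>" "?N u = ?N (real l / real n + \<epsilon>)"
        by (rule points_upto_right_constant[OF _ l(1), of "{1..n}"]) auto
      then show ?thesis using False l that[of u] by (simp add: max_def split: if_splits)
    qed
    have "real (?N u) / real n \<le> real l / real n"
      using u(3) by (intro divide_right_mono) auto
    with u show "\<exists>u\<in>{\<alpha>..\<beta>}. real (?N u) / real n + \<epsilon> < u"
      by (intro bexI[of _ u]) auto
  qed
  finally show ?thesis .
qed

section \<open>Closed form of the probability\<close>

lemma sum_int_interval_eq_sum_nat:
  fixes f :: "int \<Rightarrow> 'b::comm_monoid_add"
  shows "(\<Sum>l = int a..b - 1. f l) = (\<Sum>l = a..<nat b. f (int l))"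
  \<comment> \<open>For \<open>b \<le> int a\<close>, negative \<open>b\<close> included, both
    ranges are empty.\<close>
  by (rule sum.reindex_bij_witness[where i = int and j = nat]) auto

text \<open>At \<open>l = K\<close> the defining sum has the single term \<open>k = K\<close>, with
  Abel factor \<open>1\<close>. So the pure power persists one index beyond the constant thresholds,
  which explains the \<open>+ 1\<close> in \<open>m\<close>.\<close>

lemma first_passage_coeff_le:
  assumes "l \<le> K"
  shows "first_passage_coeff a d z K l = a ^ l"
  using assms by (cases "l = K") (auto simp: first_passage_coeff_def)

text \<open>The sum over all \<open>k\<close> has the closed form of
  \<open>sum_binomial_power_abel_poly\<close>; removing the terms with \<open>k < K\<close> leaves a
  correction whose length does not grow with \<open>l\<close>.\<close>

lemma first_passage_coeff_greater:
  fixes a d z :: real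
  assumes "K < l" "d + real l * z \<noteq> 0"
  shows "first_passage_coeff a d z K l = (a + d) * (a + d + real l * z) ^ (l - 1) -
    (\<Sum>k<K. (d + real k * z) * real (l choose k) * (d + real l * z) ^ (l - k - 1) * a ^ k)"
proof -
  let ?g = "\<lambda>k. of_nat (l choose k) * a ^ k * abel_poly (d + of_nat k * z) z (l - k)"
  have "{..l} = {..<K} \<union> {K..l}" using assms by auto
  then have "(\<Sum>k\<le>l. ?g k) = (\<Sum>k<K. ?g k) + first_passage_coeff a d z K l"
    using assms by (simp add: sum.union_disjoint ivl_disj_int first_passage_coeff_def)
  moreover have "(\<Sum>k\<le>l. ?g k) = (a + d) * (a + d + real l * z) ^ (l - 1)"
    using assms sum_binomial_power_abel_poly[of d l z a] by (simp add: abel_poly_def)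
  moreover have "(\<Sum>k<K. ?g k) =
      (\<Sum>k<K. (d + real k * z) * real (l choose k) * (d + real l * z) ^ (l - k - 1) * a ^ k)"
  proof (intro sum.cong refl)
    fix k assume "k \<in> {..<K}"
    then have "l - k \<noteq> 0" "d + real k * z + real (l - k) * z = d + real l * z"
      using assms by (auto simp: of_nat_diff algebra_simps)
    then have "abel_poly (d + real k * z) z (l - k) = (d + real k * z) * (d + real l * z) ^ (l - k - 1)"
      unfolding abel_poly_def by (simp only: if_False)
    then show "?g k = (d + real k * z) * real (l choose k) * (d + real l * z) ^ (l - k - 1) * a ^ k"
      by (simp only: mult_ac)
  qed
  ultimately show ?thesis by simp
qed

lemma power_int_diff_nat: "l \<le> n \<Longrightarrow> x powi (int n - int l) = x ^ (n - l)"
  by (simp add: of_nat_diff[symmetric] del: of_nat_diff)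

theorem theorem4:
  fixes M :: "'a measure"
    and X :: "nat \<Rightarrow> 'a \<Rightarrow> real"
    and U :: "real \<Rightarrow> real"
    and n :: nat
    and \<alpha> \<beta> \<epsilon> n\<^sub>\<alpha> :: real
    and nbar m :: int
  assumes prob_M: "prob_space M"
    and n_pos: "n \<ge> 1"
    and indep: "prob_space.indep_vars M (\<lambda>_. borel) X {1..n}"
    and uniform: "\<And>i. i \<in> {1..n} \<Longrightarrow> distr M borel (X i) = uniform_measure lborel {0..1}"
    and interval: "0 \<le> \<alpha>" "\<alpha> \<le> \<beta>" "\<beta> \<le> 1"
    and eps: "\<epsilon> > 0"
    and U: "\<And>u. u \<in> {0..1} \<Longrightarrow> U u = u"
    and nbar: "nbar = \<lceil>real n * (\<beta> - \<epsilon>)\<rceil>"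
    and n_alpha: "n\<^sub>\<alpha> = real n * (\<alpha> - \<epsilon>)"
    and m: "m = min (\<lfloor>n\<^sub>\<alpha>\<rfloor> + 1) (nbar - 1)"
  shows
    "(n\<^sub>\<alpha> > 0 \<longrightarrow>
       \<P>(\<omega> in M. (SUP u\<in>{\<alpha>..\<beta>}. U u - emp_cdf n (\<lambda>i. X i \<omega>) u) > \<epsilon>) =
         (\<Sum>l=0..m. real (n choose nat l)
            * (min (1 - of_int l / real n - \<epsilon>) (1 - \<alpha>)) powi (int n - l) * \<alpha> powi l)
       + (\<Sum>l=m+1..nbar-1. real (n choose nat l)
            * (1 - of_int l / real n - \<epsilon>) powi (int n - l)
            * (\<epsilon> * (of_int l / real n + \<epsilon>) powi (l - 1)
               + (\<Sum>j=0..m-1. (n\<^sub>\<alpha> - of_int j) / real n * real (nat l choose nat j)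
                    * ((of_int l - n\<^sub>\<alpha>) / real n) powi (l - j - 1) * \<alpha> powi j))))
     \<and> (n\<^sub>\<alpha> < 0 \<longrightarrow>
       \<P>(\<omega> in M. (SUP u\<in>{\<alpha>..\<beta>}. U u - emp_cdf n (\<lambda>i. X i \<omega>) u) > \<epsilon>) =
         (\<Sum>l=0..nbar-1. real (n choose nat l)
            * (1 - of_int l / real n - \<epsilon>) powi (int n - l)
            * (\<epsilon> * (of_int l / real n + \<epsilon>) powi (l - 1))))"
proof -
  have sample: "uniform_sample M X {1..n}"
    using prob_M indep uniform by (simp add: uniform_sample_def uniform_sample_axioms_def)
  define L where "L = nat nbar"
  define s where "s l = max (real l / real n + \<epsilon>) \<alpha>" for l
  let ?P = "\<P>(\<omega> in M. (SUP u\<in>{\<alpha>..\<beta>}. U u - emp_cdf n (\<lambda>i. X i \<omega>) u) > \<epsilon>)"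
  have less_L: "real l / real n + \<epsilon> < \<beta>" if "l < L" for l
  proof -
    have "real l < real n * (\<beta> - \<epsilon>)"
      using that by (simp add: L_def nbar zless_nat_eq_int_zless less_ceiling_iff)
    then show ?thesis using n_pos by (simp add: field_simps)
  qed
  have le_n: "l \<le> n" if "l < L" for l
  proof -
    have "real l / real n < 1" using less_L[OF that] interval eps by linarith
    then show ?thesis using n_pos by (simp add: field_simps)
  qed
  \<comment> \<open>Any solution \<open>q\<close> of the recursion serves; the two signs of
    \<open>n\<^sub>\<alpha>\<close> lead to different parameters.\<close>
  have prob_eq: "?P = (\<Sum>l<L. real (n choose l) * q l * (1 - s l) ^ (n - l))"
    if q: "\<And>l. (\<Sum>j\<le>l. real (l choose j) * q j * (s l - s j) ^ (l - j)) = s l ^ l" for q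
  proof -
    have "?P = \<P>(\<omega> in M. \<exists>l<L. points_upto {1..n} (\<lambda>i. X i \<omega>) (s l) \<le> l)"
      unfolding L_def s_def nbar
      by (subst SUP_deviation_greater_iff[OF n_pos interval(2)]) (use U interval in auto)
    also have "\<dots> = (\<Sum>l<L. real (n choose l) * q l * (1 - s l) ^ (n - l))"
    proof (subst uniform_sample.prob_ex_points_upto_le[OF sample _ _ q])
      show "mono s"
        unfolding s_def by (intro monoI max.mono add_right_mono divide_right_mono) auto
      show "0 \<le> s l" for l
        using interval by (simp add: s_def le_max_iff_disj)
      show "s l \<le> 1" if "l < L" for l
        using less_L[OF that] interval by (simp add: s_def)
    qed simp
    finally show ?thesis .
  qed
  show ?thesis
  proof (intro conjI impI)
    assume "n\<^sub>\<alpha> < 0"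
    then have "\<alpha> < \<epsilon>"
      using n_pos by (simp add: n_alpha mult_less_0_iff)
    \<comment> \<open>The thresholds are affine from the start, so the parameters are
      \<open>a = 0\<close>, \<open>d = \<epsilon>\<close> and \<open>K = 0\<close>.\<close>
    have s: "s l = \<epsilon> + real l * (1 / real n)" for l
    proof -
      have "0 \<le> real l / real n" by simp
      then have "\<alpha> \<le> real l / real n + \<epsilon>" using \<open>\<alpha> < \<epsilon>\<close> by linarith
      then show ?thesis by (simp add: s_def max_absorb1)
    qed
    have pos: "0 < \<epsilon> + real l * (1 / real n)" for l
      using eps by (intro add_pos_nonneg) auto
    \<comment> \<open>At \<open>l = 0\<close> the exponent is \<open>-1\<close>, and
      \<open>\<epsilon> * \<epsilon> powi (-1) = 1\<close> agrees with the convention in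
      \<open>abel_poly\<close>.\<close>
    have coeff: "first_passage_coeff 0 \<epsilon> (1 / real n) 0 l = \<epsilon> * (real l / real n + \<epsilon>) powi (int l - 1)" for l
    proof (cases l)
      case 0
      then show ?thesis using eps by (simp add: first_passage_coeff_le)
    next
      case (Suc k)
      then have "int l - 1 = int k" by simp
      then show ?thesis
        using Suc first_passage_coeff_greater[of 0 l \<epsilon> "1 / real n" 0] pos[of l]
        by (simp only: power_int_of_nat) (simp add: add.commute del: of_nat_Suc)
    qed
    have "?P = (\<Sum>l<L. real (n choose l) * first_passage_coeff 0 \<epsilon> (1 / real n) 0 l * (1 - s l) ^ (n - l))"
      using first_passage_coeff_recursion[where a = 0 and d = \<epsilon> and z = "1 / real n" and K = 0]
      by (intro prob_eq) (simp add: s)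
    also have "\<dots> = (\<Sum>l=0..<nat nbar. real (n choose l) * (1 - real l / real n - \<epsilon>) powi (int n - int l)
            * (\<epsilon> * (real l / real n + \<epsilon>) powi (int l - 1)))"
      unfolding L_def[symmetric] atLeast0LessThan
      by (intro sum.cong refl) (simp add: le_n power_int_diff_nat coeff s diff_diff_eq add.commute mult_ac)
    finally show "?P = (\<Sum>l=0..nbar-1. real (n choose nat l)
            * (1 - of_int l / real n - \<epsilon>) powi (int n - l)
            * (\<epsilon> * (of_int l / real n + \<epsilon>) powi (l - 1)))"
      using sum_int_interval_eq_sum_nat[where a = 0 and b = nbar and f = "\<lambda>l. real (n choose nat l)
            * (1 - of_int l / real n - \<epsilon>) powi (int n - l)
            * (\<epsilon> * (of_int l / real n + \<epsilon>) powi (l - 1))"]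
      by simp
  next
    assume n_alpha_pos: "n\<^sub>\<alpha> > 0"
    \<comment> \<open>\<open>K\<close> is the number of indices \<open>l\<close> with
      \<open>l / n + \<epsilon> \<le> \<alpha>\<close>, that is, with threshold
      \<open>\<alpha>\<close>; \<open>m'\<close> is \<open>m\<close> as a natural number.\<close>
    define K where "K = nat (\<lfloor>n\<^sub>\<alpha>\<rfloor> + 1)"
    define m' where "m' = min K (L - 1)"
    have "\<epsilon> < \<alpha>"
      using n_alpha_pos n_pos by (simp add: n_alpha zero_less_mult_iff)
    then have "0 < real n * (\<beta> - \<epsilon>)"
      using n_pos interval by (intro mult_pos_pos) auto
    then have "nbar > 0" by (simp add: nbar)
    then have nbar_eq: "nbar = int L" and "L \<ge> 1" by (auto simp: L_def)
    have "\<lfloor>n\<^sub>\<alpha>\<rfloor> \<ge> 0" using n_alpha_pos by simp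
    then have "\<lfloor>n\<^sub>\<alpha>\<rfloor> + 1 = int K" by (simp add: K_def)
    then have m_eq: "m = int m'"
      using \<open>L \<ge> 1\<close> by (simp add: m m'_def nbar_eq)
    have less_K: "l < K \<longleftrightarrow> real l / real n + \<epsilon> \<le> \<alpha>" for l
    proof -
      have "l < K \<longleftrightarrow> int l \<le> \<lfloor>n\<^sub>\<alpha>\<rfloor>"
        by (auto simp: K_def)
      also have "\<dots> \<longleftrightarrow> real l \<le> real n * (\<alpha> - \<epsilon>)"
        by (simp add: le_floor_iff n_alpha)
      also have "\<dots> \<longleftrightarrow> real l / real n + \<epsilon> \<le> \<alpha>"
        using n_pos by (simp add: field_simps)
      finally show ?thesis .
    qed
    have s: "s l = (if l < K then \<alpha> else \<alpha> + (\<epsilon> - \<alpha>) + real l * (1 / real n))" for l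
      by (auto simp: s_def less_K)
    let ?q = "first_passage_coeff \<alpha> (\<epsilon> - \<alpha>) (1 / real n) K"
    let ?f = "\<lambda>l. real (n choose l) * ?q l * (1 - s l) ^ (n - l)"
    have "?P = (\<Sum>l<L. ?f l)"
      using first_passage_coeff_recursion[where a = \<alpha> and d = "\<epsilon> - \<alpha>" and z = "1 / real n" and K = K]
      by (intro prob_eq) (simp only: s)
    also have "{..<L} = {0..<Suc m'} \<union> {Suc m'..<L}"
      using \<open>L \<ge> 1\<close> by (auto simp: m'_def)
    also have "(\<Sum>l\<in>\<dots>. ?f l) = (\<Sum>l=0..<Suc m'. ?f l) + (\<Sum>l=Suc m'..<L. ?f l)"
      by (intro sum.union_disjoint) auto
    also have "(\<Sum>l=0..<Suc m'. ?f l) = (\<Sum>l=0..<Suc m'. real (n choose l)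
            * (min (1 - real l / real n - \<epsilon>) (1 - \<alpha>)) powi (int n - int l) * \<alpha> powi int l)"
    proof (intro sum.cong refl)
      fix l assume l: "l \<in> {0..<Suc m'}"
      then have "l \<le> K" "l < L" using \<open>L \<ge> 1\<close> by (auto simp: m'_def)
      moreover have "1 - s l = min (1 - real l / real n - \<epsilon>) (1 - \<alpha>)"
        by (auto simp: s_def)
      ultimately show "?f l = real (n choose l)
            * (min (1 - real l / real n - \<epsilon>) (1 - \<alpha>)) powi (int n - int l) * \<alpha> powi int l"
        by (simp add: le_n power_int_diff_nat first_passage_coeff_le)
    qed
    also have "\<dots> = (\<Sum>l=0..m. real (n choose nat l)
            * (min (1 - of_int l / real n - \<epsilon>) (1 - \<alpha>)) powi (int n - l) * \<alpha> powi l)"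
      using sum_int_interval_eq_sum_nat[where a = 0 and b = "m + 1" and f = "\<lambda>l. real (n choose nat l)
            * (min (1 - of_int l / real n - \<epsilon>) (1 - \<alpha>)) powi (int n - l) * \<alpha> powi l"]
      by (simp add: m_eq nat_add_distrib)
    also have "(\<Sum>l=Suc m'..<L. ?f l) = (\<Sum>l=Suc m'..<L. real (n choose l)
            * (1 - real l / real n - \<epsilon>) powi (int n - int l)
            * (\<epsilon> * (real l / real n + \<epsilon>) powi (int l - 1)
               + (\<Sum>j=0..m-1. (n\<^sub>\<alpha> - of_int j) / real n * real (l choose nat j)
                    * ((real l - n\<^sub>\<alpha>) / real n) powi (int l - j - 1) * \<alpha> powi j)))"
    proof (intro sum.cong refl)
      fix l assume l: "l \<in> {Suc m'..<L}"
      \<comment> \<open>A nonempty second range rules out \<open>m' = L - 1\<close>, so the minimum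
        is \<open>K\<close>.\<close>
      then have m'_eq: "m' = K" and lK: "K < l" and "l < L" by (auto simp: m'_def)
      have w: "\<epsilon> - \<alpha> + real l * (1 / real n) = (real l - n\<^sub>\<alpha>) / real n"
        using n_pos by (simp add: n_alpha field_simps)
      have "\<epsilon> - \<alpha> + real l * (1 / real n) \<noteq> 0"
        using less_K[of l] lK by simp
      note coeff = first_passage_coeff_greater[OF lK this, of \<alpha>]
      have "(\<Sum>j=0..m-1. (n\<^sub>\<alpha> - of_int j) / real n * real (l choose nat j)
                    * ((real l - n\<^sub>\<alpha>) / real n) powi (int l - j - 1) * \<alpha> powi j) =
            (\<Sum>j=0..<K. (n\<^sub>\<alpha> - real j) / real n * real (l choose j)
                    * ((real l - n\<^sub>\<alpha>) / real n) powi (int l - int j - 1) * \<alpha> powi int j)"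
        using sum_int_interval_eq_sum_nat[where a = 0 and b = m and
            f = "\<lambda>j. (n\<^sub>\<alpha> - of_int j) / real n * real (l choose nat j)
                    * ((real l - n\<^sub>\<alpha>) / real n) powi (int l - j - 1) * \<alpha> powi j"]
        by (simp add: m_eq m'_eq)
      \<comment> \<open>The factor \<open>(n\<^sub>\<alpha> - j) / n\<close> is the negative of
        \<open>d + j * z\<close>, so the sum subtracted in
        \<open>first_passage_coeff_greater\<close> appears with a plus sign;
        \<open>j < K < l\<close> keeps the exponent nonnegative.\<close>
      also have "\<dots> = (\<Sum>j=0..<K. - ((\<epsilon> - \<alpha> + real j * (1 / real n)) * real (l choose j)
                    * (\<epsilon> - \<alpha> + real l * (1 / real n)) ^ (l - j - 1) * \<alpha> ^ j))"
      proof (intro sum.cong refl)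
        fix j assume j: "j \<in> {0..<K}"
        then have "int l - int j - 1 = int (l - j - 1)" using lK by simp
        moreover have "(n\<^sub>\<alpha> - real j) / real n = - (\<epsilon> - \<alpha> + real j * (1 / real n))"
          using n_pos by (simp add: n_alpha field_simps)
        ultimately show "(n\<^sub>\<alpha> - real j) / real n * real (l choose j)
                    * ((real l - n\<^sub>\<alpha>) / real n) powi (int l - int j - 1) * \<alpha> powi int j =
            - ((\<epsilon> - \<alpha> + real j * (1 / real n)) * real (l choose j)
                    * (\<epsilon> - \<alpha> + real l * (1 / real n)) ^ (l - j - 1) * \<alpha> ^ j)"
          by (simp only: w power_int_of_nat mult_minus_left)
      qed
      finally have sum_eq: "(\<Sum>j=0..m-1. (n\<^sub>\<alpha> - of_int j) / real n * real (l choose nat j)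
                    * ((real l - n\<^sub>\<alpha>) / real n) powi (int l - j - 1) * \<alpha> powi j) =
            - (\<Sum>j<K. (\<epsilon> - \<alpha> + real j * (1 / real n)) * real (l choose j)
                    * (\<epsilon> - \<alpha> + real l * (1 / real n)) ^ (l - j - 1) * \<alpha> ^ j)"
        by (simp add: sum_negf atLeast0LessThan)
      have "1 - s l = 1 - real l / real n - \<epsilon>"
        using lK by (simp add: s)
      moreover have "\<epsilon> * (real l / real n + \<epsilon>) powi (int l - 1) =
          (\<alpha> + (\<epsilon> - \<alpha>)) * (\<alpha> + (\<epsilon> - \<alpha>) + real l * (1 / real n)) ^ (l - 1)"
        using lK power_int_diff_nat[of 1 l "real l / real n + \<epsilon>"] by (simp add: add.commute)
      ultimately show "?f l = real (n choose l)
            * (1 - real l / real n - \<epsilon>) powi (int n - int l)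
            * (\<epsilon> * (real l / real n + \<epsilon>) powi (int l - 1)
               + (\<Sum>j=0..m-1. (n\<^sub>\<alpha> - of_int j) / real n * real (l choose nat j)
                    * ((real l - n\<^sub>\<alpha>) / real n) powi (int l - j - 1) * \<alpha> powi j))"
        unfolding sum_eq coeff power_int_diff_nat[OF le_n[OF \<open>l < L\<close>]]
        by (simp only: add_uminus_conv_diff mult_ac)
    qed
    also have "\<dots> = (\<Sum>l=m+1..nbar-1. real (n choose nat l)
            * (1 - of_int l / real n - \<epsilon>) powi (int n - l)
            * (\<epsilon> * (of_int l / real n + \<epsilon>) powi (l - 1)
               + (\<Sum>j=0..m-1. (n\<^sub>\<alpha> - of_int j) / real n * real (nat l choose nat j)
                    * ((of_int l - n\<^sub>\<alpha>) / real n) powi (l - j - 1) * \<alpha> powi j)))"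
    proof -
      have "m + 1 = int (Suc m')" "L = nat nbar" by (simp_all add: m_eq L_def)
      then show ?thesis by (simp only: sum_int_interval_eq_sum_nat nat_int of_int_of_nat_eq)
    qed
    finally show "?P =
         (\<Sum>l=0..m. real (n choose nat l)
            * (min (1 - of_int l / real n - \<epsilon>) (1 - \<alpha>)) powi (int n - l) * \<alpha> powi l)
       + (\<Sum>l=m+1..nbar-1. real (n choose nat l)
            * (1 - of_int l / real n - \<epsilon>) powi (int n - l)
            * (\<epsilon> * (of_int l / real n + \<epsilon>) powi (l - 1)
               + (\<Sum>j=0..m-1. (n\<^sub>\<alpha> - of_int j) / real n * real (nat l choose nat j)
                    * ((of_int l - n\<^sub>\<alpha>) / real n) powi (l - j - 1) * \<alpha> powi j)))" .
  qed
qed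

end
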